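(* Let $E$ be a complex vector bundle of rank $2$ over $T^2$ with Hermitian metric $h$, and let $\nabla$ be an $h$-connection of $E$. Suppose that $G_\nabla$ contains two elements $B_1,B_2\in U(2)$ satisfying $$B_1=B(\psi\pi),\qquad B_2=e^{\sqrt{-1}\gamma}\,U B(q\pi)\,{}^t\overline U,\qquad \phi\in(0,\pi/2]$$ for $q\in\mathbb{Q}\setminus\mathbb{Z}$ and $\psi,\gamma\in\mathbb{R}\setminus\mathbb{Q}$, where $U=\begin{pmatrix}\alpha&-\overline\beta\\\beta&\overline\alpha\end{pmatrix}$ with $\alpha,\beta\in\mathbb{C}$, $|\alpha|^2+|\beta|^2=1$, and $U$ satisfies $\cos\phi=|\alpha|^2-|\beta|^2$. Then the topological holonomy group $G_\nabla$ is dense in $U(2)$.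
   Context: $T^2=S^1\times S^1$ with $S^1=\mathbb{R}/2\pi\mathbb{Z}$ and $\mathrm{pr}:\mathbb{R}^2\to T^2$ is the standard projection. An $h$-connection is a connection $\nabla$ of $E$ with $\nabla h=0$; the induced metric and connection on the pull-back bundle $\mathrm{pr}^*E$ are denoted by the same symbols. Let $\tilde v_1,\tilde v_2$ be an orthonormal basis of $\mathrm{pr}^*E_{(0,0)}$ with respect to $h$, and for $i=1,2$ let $\tilde\xi_{i,x}$ (resp. $\tilde\xi_{i,y}$) be the $\nabla$-parallel section of the restriction of $\mathrm{pr}^*E$ to the $x$-axis (resp. $y$-axis) with value $\tilde v_i$ at $(0,0)$. Identifying the fibers of $\mathrm{pr}^*E$ at $(x+2\pi m,y+2\pi n)$ and $(x,y)$ for $m,n\in\mathbb{Z}$, there are $D_1,D_2\in U(2)$ with $(\tilde\xi_{1,x}(a+2\pi,0)\ \tilde\xi_{2,x}(a+2\pi,0))=(\tilde\xi_{1,x}(a,0)\ \tilde\xi_{2,x}(a,0))D_1$ and $(\tilde\xi_{1,y}(0,b+2\pi)\ \tilde\xi_{2,y}(0,b+2\pi))=(\tilde\xi_{1,y}(0,b)\ \tilde\xi_{2,y}(0,b))D_2$ for all $a,b\in\mathbb{R}$. The topological holonomy group $G_\nabla$ of $\nabla$ at $\mathrm{pr}(0,0)$ is the subgroup of $U(2)$ generated by $D_1,D_2$ (uniquely determined up to a conjugate subgroup of $U(2)$). For $\theta\in\mathbb{R}$, $B(\theta)=\exp(-(\theta/2)I_1)\in SU(2)$ with $I_1=\mathrm{diag}(\sqrt{-1},-\sqrt{-1})$,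 i.e. $B(\theta)=\mathrm{diag}(e^{-\sqrt{-1}\theta/2},e^{\sqrt{-1}\theta/2})$.
   Formalization: The scalar of B_2 is taken as e^{√-1 γπ} with γ irrational, i.e. γ/π rather than γ is required irrational in e^{√-1 γ}; as printed the claim fails, e.g. for γ=π both B_1, B_2 lie in SU(2) and can generate G_∇. *)

theory Defs
  imports "HOL-Analysis.Analysis" "HOL-Algebra.Generated_Groups"
begin

section \<open>The torus\<close>

quotient_type circle = real / "\<lambda>x y. \<exists>k::int. x - y = 2 * pi * of_int k"
  morphisms rep_circle circle_of
proof (rule equivpI)
  show "reflp (\<lambda>x y. \<exists>k::int. x - y = 2 * pi * of_int k)"
    by (rule reflpI) (rule exI[of _ 0], simp)
  show "symp (\<lambda>x y. \<exists>k::int. x - y = 2 * pi * of_int k)"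
  proof (rule sympI)
    fix x y :: real assume "\<exists>k::int. x - y = 2 * pi * of_int k"
    then obtain k :: int where "x - y = 2 * pi * of_int k" by blast
    then have "y - x = 2 * pi * of_int (- k)" by simp
    then show "\<exists>k::int. y - x = 2 * pi * of_int k" by blast
  qed
  show "transp (\<lambda>x y. \<exists>k::int. x - y = 2 * pi * of_int k)"
  proof (rule transpI)
    fix x y z :: real
    assume "\<exists>k::int. x - y = 2 * pi * of_int k" "\<exists>k::int. y - z = 2 * pi * of_int k"
    then obtain k l :: int where "x - y = 2 * pi * of_int k" "y - z = 2 * pi * of_int l" by blast
    then have "x - z = 2 * pi * of_int (k + l)" by (simp add: algebra_simps)
    then show "\<exists>k::int. x - z = 2 * pi * of_int k" by blast
  qed
qed

type_synonym torus = "circle \<times> circle"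

definition pr :: "real \<times> real \<Rightarrow> torus" where
  "pr p = (circle_of (fst p), circle_of (snd p))"

text \<open>
  The topology and the smooth structure of the torus are the quotient ones: a set \<open>U\<close> is
  open iff \<open>pr -` U\<close> is open, and a function on \<open>U\<close> is smooth iff its composition with
  \<open>pr\<close> is smooth on \<open>pr -` U\<close>. The coordinate fields trivialise the tangent bundle, so a
  vector field on the torus is a function \<open>torus \<Rightarrow> real \<times> real\<close>.
\<close>

primrec Ck_on :: "nat \<Rightarrow> (real \<times> real) set \<Rightarrow> (real \<times> real \<Rightarrow> 'b::real_normed_vector) \<Rightarrow> bool" where
  "Ck_on 0 S f \<longleftrightarrow> continuous_on S f"
| "Ck_on (Suc k) S f \<longleftrightarrow>
     f differentiable_on S \<and> (\<forall>v. Ck_on k S (\<lambda>p. frechet_derivative f (at p) v))"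

text \<open>Only used for open \<open>S\<close>.\<close>
definition smooth_on :: "(real \<times> real) set \<Rightarrow> (real \<times> real \<Rightarrow> 'b::real_normed_vector) \<Rightarrow> bool" where
  "smooth_on S f \<longleftrightarrow> (\<forall>k. Ck_on k S f)"

definition smooth_fun :: "(torus \<Rightarrow> 'b::real_normed_vector) \<Rightarrow> bool" where
  "smooth_fun f \<longleftrightarrow> smooth_on UNIV (\<lambda>p. f (pr p))"

definition dir_deriv :: "(torus \<Rightarrow> 'b::real_normed_vector) \<Rightarrow> real \<times> real \<Rightarrow> real \<times> real \<Rightarrow> 'b" where
  "dir_deriv f p v = frechet_derivative (\<lambda>r. f (pr r)) (at p) v"

section \<open>Complex vector bundles of rank 2 over the torus\<close>

text \<open>
  The total space of the bundle is the type \<open>'e\<close>. The operations \<open>vadd\<close> and \<open>vscale\<close> are only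
  meaningful within a fibre. An element \<open>(U, \<Phi>)\<close> of \<open>atlas\<close> is a local trivialisation
  \<open>(x, u) \<mapsto> \<Phi> x u\<close> of the bundle over \<open>U\<close>. The fibrewise linear bijections with
  \<open>complex ^ 2\<close> make every fibre a complex vector space of dimension 2, and the smooth
  structure of the total space is the one for which all these trivialisations are diffeomorphisms.
\<close>

record 'e vbundle =
  proj :: "'e \<Rightarrow> torus"
  vadd :: "'e \<Rightarrow> 'e \<Rightarrow> 'e"
  vscale :: "complex \<Rightarrow> 'e \<Rightarrow> 'e"
  atlas :: "(torus set \<times> (torus \<Rightarrow> complex ^ 2 \<Rightarrow> 'e)) set"

definition fibre :: "'e vbundle \<Rightarrow> torus \<Rightarrow> 'e set" where
  "fibre E x = {e. proj E e = x}"

definition coords :: "(torus \<Rightarrow> complex ^ 2 \<Rightarrow> 'e) \<Rightarrow> torus \<Rightarrow> 'e \<Rightarrow> complex ^ 2" where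
  "coords \<Phi> x = inv_into UNIV (\<Phi> x)"

locale rank2_bundle =
  fixes E :: "'e vbundle"
  assumes atlas_open: "(U, \<Phi>) \<in> atlas E \<Longrightarrow> open (pr -` U)"
    and atlas_cover: "\<exists>(U, \<Phi>) \<in> atlas E. x \<in> U"
    and atlas_bij: "(U, \<Phi>) \<in> atlas E \<Longrightarrow> x \<in> U \<Longrightarrow> bij_betw (\<Phi> x) UNIV (fibre E x)"
    and atlas_add: "(U, \<Phi>) \<in> atlas E \<Longrightarrow> x \<in> U \<Longrightarrow> \<Phi> x (u + w) = vadd E (\<Phi> x u) (\<Phi> x w)"
    and atlas_scale: "(U, \<Phi>) \<in> atlas E \<Longrightarrow> x \<in> U \<Longrightarrow> \<Phi> x (c *s u) = vscale E c (\<Phi> x u)"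
    and atlas_smooth: "(U, \<Phi>) \<in> atlas E \<Longrightarrow> (V, \<Psi>) \<in> atlas E \<Longrightarrow>
          smooth_on (pr -` (U \<inter> V)) (\<lambda>p. coords \<Psi> (pr p) (\<Phi> (pr p) u))"

definition smooth_section :: "'e vbundle \<Rightarrow> (torus \<Rightarrow> 'e) \<Rightarrow> bool" where
  "smooth_section E s \<longleftrightarrow> (\<forall>x. s x \<in> fibre E x) \<and>
     (\<forall>(U, \<Phi>) \<in> atlas E. smooth_on (pr -` U) (\<lambda>p. coords \<Phi> (pr p) (s (pr p))))"

definition lincomb :: "'e vbundle \<Rightarrow> (2 \<Rightarrow> complex) \<Rightarrow> (2 \<Rightarrow> 'e) \<Rightarrow> 'e" where
  "lincomb E a u = vadd E (vscale E (a 1) (u 1)) (vscale E (a 2) (u 2))"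

text \<open>The zero vector of the fibre of \<open>u\<close> is \<open>vscale E 0 u\<close>.\<close>
locale hermitian_metric = rank2_bundle E for E :: "'e vbundle" +
  fixes h :: "'e \<Rightarrow> 'e \<Rightarrow> complex"
  assumes h_add: "u \<in> fibre E x \<Longrightarrow> v \<in> fibre E x \<Longrightarrow> w \<in> fibre E x \<Longrightarrow>
            h (vadd E u v) w = h u w + h v w"
    and h_scale: "u \<in> fibre E x \<Longrightarrow> w \<in> fibre E x \<Longrightarrow> h (vscale E c u) w = c * h u w"
    and h_cnj: "u \<in> fibre E x \<Longrightarrow> w \<in> fibre E x \<Longrightarrow> h w u = cnj (h u w)"
    and h_pos: "u \<noteq> vscale E 0 u \<Longrightarrow> 0 < Re (h u u)"
    and h_smooth: "(U, \<Phi>) \<in> atlas E \<Longrightarrow>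
            smooth_on (pr -` U) (\<lambda>p. h (\<Phi> (pr p) a) (\<Phi> (pr p) b))"

section \<open>Connections\<close>

text \<open>
  A connection is given as a covariant derivative \<open>\<nabla> X s\<close> of smooth sections \<open>s\<close> along smooth
  vector fields \<open>X\<close>; its values on other arguments are irrelevant.
\<close>
locale bundle_connection = rank2_bundle E for E :: "'e vbundle" +
  fixes nabla :: "(torus \<Rightarrow> real \<times> real) \<Rightarrow> (torus \<Rightarrow> 'e) \<Rightarrow> torus \<Rightarrow> 'e"
  assumes nabla_section: "smooth_fun X \<Longrightarrow> smooth_section E s \<Longrightarrow> smooth_section E (nabla X s)"
    and nabla_add_field: "smooth_fun X \<Longrightarrow> smooth_fun Y \<Longrightarrow> smooth_section E s \<Longrightarrow>
          nabla (\<lambda>y. X y + Y y) s x = vadd E (nabla X s x) (nabla Y s x)"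
    and nabla_scale_field: "smooth_fun (f :: torus \<Rightarrow> real) \<Longrightarrow> smooth_fun X \<Longrightarrow> smooth_section E s \<Longrightarrow>
          nabla (\<lambda>y. f y *\<^sub>R X y) s x = vscale E (complex_of_real (f x)) (nabla X s x)"
    and nabla_add_section: "smooth_fun X \<Longrightarrow> smooth_section E s \<Longrightarrow> smooth_section E t \<Longrightarrow>
          nabla X (\<lambda>y. vadd E (s y) (t y)) x = vadd E (nabla X s x) (nabla X t x)"
    and nabla_leibniz: "smooth_fun X \<Longrightarrow> smooth_fun (g :: torus \<Rightarrow> complex) \<Longrightarrow> smooth_section E s \<Longrightarrow>
          nabla X (\<lambda>y. vscale E (g y) (s y)) (pr p) =
            vadd E (vscale E (dir_deriv g p (X (pr p))) (s (pr p)))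
                   (vscale E (g (pr p)) (nabla X s (pr p)))"

text \<open>\<open>\<nabla>h = 0\<close>.\<close>
locale h_connection = hermitian_metric E h + bundle_connection E nabla
  for E :: "'e vbundle" and h nabla +
  assumes nabla_metric: "smooth_fun X \<Longrightarrow> smooth_section E s \<Longrightarrow> smooth_section E t \<Longrightarrow>
      dir_deriv (\<lambda>y. h (s y) (t y)) p (X (pr p)) =
        h (nabla X s (pr p)) (t (pr p)) + h (s (pr p)) (nabla X t (pr p))"

section \<open>Parallel sections and the topological holonomy group\<close>

text \<open>
  The fibre of \<open>pr\<^sup>*E\<close> at \<open>p\<close> is \<open>fibre E (pr p)\<close>, so that the fibres at points which differ by
  periods are literally the same, and a section of \<open>pr\<^sup>*E\<close> along a curve \<open>c\<close> in the plane is a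
  function \<open>\<xi>\<close> with \<open>\<xi> r \<in> fibre E (pr (c r))\<close>. The induced covariant derivative along \<open>c\<close> is
  determined by the Leibniz rule and \<open>D (s \<circ> pr \<circ> c) = (\<nabla>\<^bsub>c'\<^esub> s) \<circ> pr \<circ> c\<close>: if
  \<open>\<xi> = \<Sum>\<^sub>i f\<^sub>i (s\<^sub>i \<circ> pr \<circ> c)\<close> near \<open>t\<close> with global smooth sections \<open>s\<^sub>i\<close> of \<open>E\<close>, then
  \<open>D \<xi> = \<Sum>\<^sub>i f\<^sub>i' (s\<^sub>i \<circ> pr \<circ> c) + \<Sum>\<^sub>i f\<^sub>i ((\<nabla>\<^bsub>c'\<^esub> s\<^sub>i) \<circ> pr \<circ> c)\<close> at \<open>t\<close>. The value does not depend
  on the choice of the \<open>f\<^sub>i\<close> and \<open>s\<^sub>i\<close>, and suitable \<open>s\<^sub>i\<close> exist by cutting off a local frame.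
\<close>
definition has_cov_deriv ::
  "'e vbundle \<Rightarrow> ((torus \<Rightarrow> real \<times> real) \<Rightarrow> (torus \<Rightarrow> 'e) \<Rightarrow> torus \<Rightarrow> 'e) \<Rightarrow>
   (real \<Rightarrow> real \<times> real) \<Rightarrow> (real \<Rightarrow> 'e) \<Rightarrow> real \<Rightarrow> 'e \<Rightarrow> bool" where
  "has_cov_deriv E nabla c \<xi> t \<eta> \<longleftrightarrow>
     (\<exists>(s :: 2 \<Rightarrow> torus \<Rightarrow> 'e) (f :: 2 \<Rightarrow> real \<Rightarrow> complex).
        (\<forall>i. smooth_section E (s i)) \<and>
        (\<forall>i. f i differentiable at t) \<and>
        (\<forall>\<^sub>F r in nhds t. \<xi> r = lincomb E (\<lambda>i. f i r) (\<lambda>i. s i (pr (c r)))) \<and>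
        \<eta> = vadd E
              (lincomb E (\<lambda>i. vector_derivative (f i) (at t)) (\<lambda>i. s i (pr (c t))))
              (lincomb E (\<lambda>i. f i t)
                 (\<lambda>i. nabla (\<lambda>_. vector_derivative c (at t)) (s i) (pr (c t)))))"

definition parallel_along ::
  "'e vbundle \<Rightarrow> ((torus \<Rightarrow> real \<times> real) \<Rightarrow> (torus \<Rightarrow> 'e) \<Rightarrow> torus \<Rightarrow> 'e) \<Rightarrow>
   (real \<Rightarrow> real \<times> real) \<Rightarrow> (real \<Rightarrow> 'e) \<Rightarrow> bool" where
  "parallel_along E nabla c \<xi> \<longleftrightarrow>
     (\<forall>t. \<xi> t \<in> fibre E (pr (c t)) \<and> has_cov_deriv E nabla c \<xi> t (vscale E 0 (\<xi> t)))"

definition x_axis :: "real \<Rightarrow> real \<times> real" where "x_axis a = (a, 0)"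

definition y_axis :: "real \<Rightarrow> real \<times> real" where "y_axis b = (0, b)"

definition orthonormal_basis :: "'e vbundle \<Rightarrow> ('e \<Rightarrow> 'e \<Rightarrow> complex) \<Rightarrow> torus \<Rightarrow> (2 \<Rightarrow> 'e) \<Rightarrow> bool" where
  "orthonormal_basis E h x v \<longleftrightarrow>
     (\<forall>i. v i \<in> fibre E x) \<and> (\<forall>i j. h (v i) (v j) = (if i = j then 1 else 0))"

text \<open>
  \<open>(\<xi>\<^sub>1 (t + 2\<pi>)  \<xi>\<^sub>2 (t + 2\<pi>)) = (\<xi>\<^sub>1 t  \<xi>\<^sub>2 t) D\<close> for the parallel frame \<open>\<xi>\<close> along \<open>c\<close> that
  starts at \<open>v\<close>. For each of the two axes there is exactly one such matrix \<open>D\<close>.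
\<close>
definition monodromy ::
  "'e vbundle \<Rightarrow> ((torus \<Rightarrow> real \<times> real) \<Rightarrow> (torus \<Rightarrow> 'e) \<Rightarrow> torus \<Rightarrow> 'e) \<Rightarrow>
   (real \<Rightarrow> real \<times> real) \<Rightarrow> (2 \<Rightarrow> 'e) \<Rightarrow> complex ^ 2 ^ 2 \<Rightarrow> bool" where
  "monodromy E nabla c v D \<longleftrightarrow>
     (\<exists>\<xi> :: 2 \<Rightarrow> real \<Rightarrow> 'e.
        (\<forall>j. parallel_along E nabla c (\<xi> j) \<and> \<xi> j 0 = v j) \<and>
        (\<forall>j t. \<xi> j (t + 2 * pi) = lincomb E (\<lambda>i. D $ i $ j) (\<lambda>i. \<xi> i t)))"

definition conj_transpose :: "complex ^ 2 ^ 2 \<Rightarrow> complex ^ 2 ^ 2" where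
  "conj_transpose A = map_matrix cnj (transpose A)"

definition U2 :: "(complex ^ 2 ^ 2) monoid" where
  "U2 = \<lparr>carrier = {A. A ** conj_transpose A = mat 1 \<and> conj_transpose A ** A = mat 1},
         mult = (**), one = mat 1\<rparr>"

text \<open>The generators are \<open>D\<^sub>1\<close> and \<open>D\<^sub>2\<close>.\<close>
definition topological_holonomy_group ::
  "'e vbundle \<Rightarrow> ((torus \<Rightarrow> real \<times> real) \<Rightarrow> (torus \<Rightarrow> 'e) \<Rightarrow> torus \<Rightarrow> 'e) \<Rightarrow> (2 \<Rightarrow> 'e) \<Rightarrow>
   (complex ^ 2 ^ 2) set" where
  "topological_holonomy_group E nabla v =
     generate U2 {D. monodromy E nabla x_axis v D \<or> monodromy E nabla y_axis v D}"

text \<open>\<open>exp (-(\<theta>/2) diag(\<i>, -\<i>))\<close>\<close>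
definition Bmat :: "real \<Rightarrow> complex ^ 2 ^ 2" where
  "Bmat \<theta> = vector [vector [exp (- \<i> * \<theta> / 2), 0], vector [0, exp (\<i> * \<theta> / 2)]]"

end

theory Submission
  imports Defs
begin

text \<open>
  Parallel transport for a connection with \<open>\<nabla>h = 0\<close> preserves \<open>h\<close>: the derivative of \<open>h \<xi> \<zeta>\<close> along
  a curve is \<open>h (D\<xi>) \<zeta> + h \<xi> (D\<zeta>)\<close>, which vanishes for parallel \<open>\<xi>\<close> and \<open>\<zeta>\<close>
  (\<open>parallel_h_constant\<close>). Hence the monodromy matrices are unitary, the holonomy group is a subgroup
  of \<open>U(2)\<close>, and its closure \<open>H\<close> is a closed subgroup (\<open>closure_closed_unitary_group\<close>). The rest is
  a statement about closed subgroups of \<open>U(2)\<close>.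

  As \<open>\<psi>\<close> is irrational, the powers of \<open>B\<^sub>1\<close> are dense in the diagonal torus \<open>T\<close> of \<open>SU(2)\<close>, so
  \<open>T \<subseteq> H\<close>. Write \<open>B\<^sub>2 = c V\<close> with a scalar \<open>c = e\<^bsup>i\<gamma>\<pi>\<^esup>\<close> and \<open>V \<in> SU(2)\<close>. The assumptions on \<open>\<phi>\<close> and
  \<open>q\<close> imply that all entries of \<open>V\<close> are nonzero: \<open>V\<close> rotates the sphere by the angle \<open>q\<pi>\<close>, which is
  not a multiple of \<open>\<pi>\<close>, about an axis that makes the angle \<open>\<phi>\<close> with the vertical one, so it neither
  fixes the vertical axis pointwise nor reverses it.
  So \<open>V T V\<^sup>*\<close>, which also lies in \<open>H\<close> because \<open>c\<close> cancels, is a torus different from \<open>T\<close>. The double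
  cosets of \<open>T\<close> in \<open>SU(2)\<close> are the level sets of the modulus of the first entry
  (\<open>same_moduli\<close>), and on \<open>V T V\<^sup>*\<close> this modulus fills an interval ending at \<open>1\<close>; hence \<open>H\<close> contains
  all real rotations by small angles (\<open>small_rotation\<close>), therefore all real rotations, therefore
  \<open>SU(2)\<close>. Finally \<open>c = B\<^sub>2 V\<^sup>-\<^sup>1 \<in> H\<close>, and as \<open>\<gamma>\<close> is irrational its powers are dense in the unit
  scalars, which together with \<open>SU(2)\<close> generate \<open>U(2)\<close> (\<open>all_unitary\<close>).
\<close>

section \<open>Parallel transport preserves the metric\<close>

context rank2_bundle
begin

lemma fibre_coords:
  assumes "(U, \<Phi>) \<in> atlas E" "x \<in> U" "u \<in> fibre E x"
  shows "\<Phi> x (coords \<Phi> x u) = u"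
  using atlas_bij [OF assms(1,2)] assms(3)
  by (auto simp: coords_def bij_betw_def intro: f_inv_into_f)

lemma trivialisation_in_fibre:
  assumes "(U, \<Phi>) \<in> atlas E" "x \<in> U"
  shows "\<Phi> x a \<in> fibre E x"
  using atlas_bij [OF assms] by (auto simp: bij_betw_def)

lemma vadd_in_fibre [simp]:
  assumes "u \<in> fibre E x" "w \<in> fibre E x"
  shows "vadd E u w \<in> fibre E x"
proof -
  obtain U \<Phi> where \<Phi>: "(U, \<Phi>) \<in> atlas E" "x \<in> U" using atlas_cover by blast
  then have "vadd E u w = \<Phi> x (coords \<Phi> x u + coords \<Phi> x w)"
    using atlas_add [OF \<Phi>] fibre_coords [OF \<Phi>] assms by simp
  then show ?thesis using trivialisation_in_fibre [OF \<Phi>] by simp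
qed

lemma vscale_in_fibre [simp]:
  assumes "u \<in> fibre E x"
  shows "vscale E c u \<in> fibre E x"
proof -
  obtain U \<Phi> where \<Phi>: "(U, \<Phi>) \<in> atlas E" "x \<in> U" using atlas_cover by blast
  then have "vscale E c u = \<Phi> x (c *s coords \<Phi> x u)"
    using atlas_scale [OF \<Phi>] fibre_coords [OF \<Phi>] assms by simp
  then show ?thesis using trivialisation_in_fibre [OF \<Phi>] by simp
qed

lemma lincomb_in_fibre [simp]: "(\<And>i. u i \<in> fibre E x) \<Longrightarrow> lincomb E a u \<in> fibre E x"
  by (simp add: lincomb_def)

text \<open>
  A local trivialisation is determined by the local frame formed by the images of the two unit
  vectors; this is the frame in which the metric is differentiated below.
\<close>
lemma trivialisation_lincomb:
  assumes "(U, \<Phi>) \<in> atlas E" "x \<in> U"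
  shows "\<Phi> x a = lincomb E (\<lambda>i. a $ i) (\<lambda>i. \<Phi> x (axis i 1))"
proof -
  have "a = a $ 1 *s axis 1 1 + a $ 2 *s axis 2 1"
    by (simp add: vec_eq_iff forall_2 axis_def)
  then have "\<Phi> x a = \<Phi> x (a $ 1 *s axis 1 1 + a $ 2 *s axis 2 1)"
    by simp
  then show ?thesis
    by (simp only: lincomb_def atlas_add [OF assms] atlas_scale [OF assms])
qed

end

lemma smooth_on_differentiable:
  assumes "smooth_on S f" "open S" "p \<in> S"
  shows "f differentiable (at p)"
proof -
  have "Ck_on (Suc 0) S f"
    using assms(1) unfolding smooth_on_def by blast
  then have "f differentiable_on S" by simp
  then show ?thesis
    using assms(2,3) by (metis at_within_open differentiable_on_def)
qed

lemma smooth_fun_const: "smooth_fun (\<lambda>_. c)"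
proof -
  have "Ck_on k UNIV (\<lambda>_ :: real \<times> real. c)" for k and c :: 'a
  proof (induction k arbitrary: c)
    case (Suc k)
    have "frechet_derivative (\<lambda>_ :: real \<times> real. c) (at p) = (\<lambda>_. 0)" for p
      by simp
    then show ?case using Suc by simp
  qed simp
  then show ?thesis by (simp add: smooth_fun_def smooth_on_def)
qed

context hermitian_metric
begin

lemma h_add_right:
  assumes "u \<in> fibre E x" "v \<in> fibre E x" "w \<in> fibre E x"
  shows "h w (vadd E u v) = h w u + h w v"
  using assms by (simp add: h_cnj [of _ x w] h_add [of _ x])

lemma h_scale_right:
  assumes "u \<in> fibre E x" "w \<in> fibre E x"
  shows "h w (vscale E c u) = cnj c * h w u"
  using assms by (simp add: h_cnj [of _ x w] h_scale [of _ x])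

lemma h_lincomb_left:
  assumes "\<And>i. u i \<in> fibre E x" "w \<in> fibre E x"
  shows "h (lincomb E a u) w = (\<Sum>i\<in>UNIV. a i * h (u i) w)"
  using assms by (simp add: lincomb_def sum_2 h_add [of _ x] h_scale [of _ x])

lemma h_lincomb_right:
  assumes "\<And>i. u i \<in> fibre E x" "w \<in> fibre E x"
  shows "h w (lincomb E a u) = (\<Sum>i\<in>UNIV. cnj (a i) * h w (u i))"
  using assms by (simp add: lincomb_def sum_2 h_add_right [of _ x] h_scale_right [of _ x])

lemma h_lincomb:
  assumes "\<And>i. u i \<in> fibre E x" "\<And>i. w i \<in> fibre E x"
  shows "h (lincomb E a u) (lincomb E b w) = (\<Sum>i\<in>UNIV. \<Sum>j\<in>UNIV. a i * cnj (b j) * h (u i) (w j))"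
  using assms by (simp add: h_lincomb_left [of _ x] h_lincomb_right [of _ x] sum_2 algebra_simps)

text \<open>
  Smoothness of \<open>h\<close> is a statement about constant coefficient vectors in a trivialisation. For
  arbitrary sections, sesquilinearity writes \<open>h s t\<close> locally as
  \<open>\<Sum>\<^sub>i \<Sum>\<^sub>j a\<^sub>i (cnj b\<^sub>j) h\<^sub>i\<^sub>j\<close> with smooth coordinates \<open>a\<close>, \<open>b\<close> and smooth coefficients \<open>h\<^sub>i\<^sub>j\<close>.
\<close>
lemma h_sections_differentiable:
  assumes "smooth_section E s" "smooth_section E t"
  shows "(\<lambda>p. h (s (pr p)) (t (pr p))) differentiable (at p)"
proof -
  obtain U \<Phi> where \<Phi>: "(U, \<Phi>) \<in> atlas E" "pr p \<in> U" using atlas_cover by blast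
  define S where "S = pr -` U"
  have S: "open S" "p \<in> S" using \<Phi> atlas_open by (auto simp: S_def)
  define A where "A r p = coords \<Phi> (pr p) (r (pr p))" for r p
  have A: "(\<lambda>p. A r p $ i) differentiable (at p)" if "smooth_section E r" for r i
  proof -
    have "A r differentiable (at p)"
      using that \<Phi>(1) S unfolding smooth_section_def A_def [abs_def] S_def
      by (blast intro: smooth_on_differentiable)
    then show ?thesis
      by (rule differentiable_compose [OF linear_imp_differentiable [OF bounded_linear.linear [OF bounded_linear_vec_nth]]])
  qed
  have cnj: "(\<lambda>p. cnj (f p)) differentiable (at p)" if "f differentiable (at p)" for f
    by (rule differentiable_compose [OF linear_imp_differentiable [OF bounded_linear.linear [OF bounded_linear_cnj]] that])
  define F where "F p = (\<Sum>i\<in>UNIV. \<Sum>j\<in>UNIV. A s p $ i * cnj (A t p $ j) *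
      h (\<Phi> (pr p) (axis i 1)) (\<Phi> (pr p) (axis j 1)))" for p
  have "F differentiable (at p)"
    unfolding F_def [abs_def] sum_2 using \<Phi> S assms
    by (intro differentiable_add differentiable_mult A cnj
        smooth_on_differentiable [OF h_smooth [OF \<Phi>(1)]]) (auto simp: S_def)
  moreover have "F p' = h (s (pr p')) (t (pr p'))" if "p' \<in> S" for p'
  proof -
    have U: "pr p' \<in> U" using that by (simp add: S_def)
    have *: "r (pr p') = lincomb E (\<lambda>i. A r p' $ i) (\<lambda>i. \<Phi> (pr p') (axis i 1))"
      if "smooth_section E r" for r
      using trivialisation_lincomb [OF \<Phi>(1) U] fibre_coords [OF \<Phi>(1) U] that
      unfolding smooth_section_def A_def by metis
    show ?thesis
      unfolding F_def * [OF assms(1)] * [OF assms(2)]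
      using trivialisation_in_fibre [OF \<Phi>(1) U] by (subst h_lincomb [of _ "pr p'"]) auto
  qed
  ultimately show ?thesis
    unfolding differentiable_def by (blast intro: has_derivative_transform_within_open [OF _ S])
qed

end

context h_connection
begin

text \<open>
  \<open>\<nabla>h = 0\<close> applied to the constant field whose value is the velocity of the curve, combined with
  the chain rule.
\<close>
lemma h_sections_along_curve:
  assumes "smooth_section E s" "smooth_section E t" "c differentiable (at r)"
  defines "X \<equiv> \<lambda>_. vector_derivative c (at r)"
  shows "((\<lambda>r. h (s (pr (c r))) (t (pr (c r)))) has_vector_derivative
      (h (nabla X s (pr (c r))) (t (pr (c r))) + h (s (pr (c r))) (nabla X t (pr (c r))))) (at r)"
proof -
  let ?F = "\<lambda>p. h (s (pr p)) (t (pr p))" and ?c' = "vector_derivative c (at r)"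
  let ?F' = "frechet_derivative ?F (at (c r))"
  have F: "(?F has_derivative ?F') (at (c r))"
    using h_sections_differentiable [OF assms(1,2)] by (simp add: frechet_derivative_works)
  have c: "(c has_derivative (\<lambda>x. x *\<^sub>R ?c')) (at r)"
    using assms(3) by (simp add: vector_derivative_works has_vector_derivative_def)
  have "((\<lambda>r. ?F (c r)) has_derivative (\<lambda>x. ?F' (x *\<^sub>R ?c'))) (at r)"
    by (rule has_derivative_compose [OF c F])
  moreover have "?F' (x *\<^sub>R ?c') = x *\<^sub>R ?F' ?c'" for x
    using has_derivative_linear [OF F] by (rule linear_scale)
  ultimately have "((\<lambda>r. ?F (c r)) has_vector_derivative ?F' ?c') (at r)"
    by (simp add: has_vector_derivative_def)
  moreover have "?F' ?c' = h (nabla X s (pr (c r))) (t (pr (c r))) + h (s (pr (c r))) (nabla X t (pr (c r)))"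
    using nabla_metric [OF smooth_fun_const assms(1,2), of "c r" ?c']
    by (simp add: dir_deriv_def X_def)
  ultimately show ?thesis by simp
qed

text \<open>
  Compatibility with the metric passes from global sections to sections along a curve: after
  expanding both sections in the global sections that witness their covariant derivatives, the
  product rule produces exactly the terms of \<open>h \<eta> \<zeta> + h \<xi> \<theta>\<close>.
\<close>
lemma h_cov_deriv:
  assumes "has_cov_deriv E nabla c \<xi> r \<eta>" "has_cov_deriv E nabla c \<zeta> r \<theta>"
    and "c differentiable (at r)"
  shows "((\<lambda>r. h (\<xi> r) (\<zeta> r)) has_vector_derivative (h \<eta> (\<zeta> r) + h (\<xi> r) \<theta>)) (at r)"
proof -
  define X :: "torus \<Rightarrow> real \<times> real" where "X = (\<lambda>_. vector_derivative c (at r))"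
  obtain s f where s: "\<And>i. smooth_section E (s i)" and f: "\<And>i. f i differentiable at r"
    and \<xi>: "\<forall>\<^sub>F r in nhds r. \<xi> r = lincomb E (\<lambda>i. f i r) (\<lambda>i. s i (pr (c r)))"
    and \<eta>: "\<eta> = vadd E (lincomb E (\<lambda>i. vector_derivative (f i) (at r)) (\<lambda>i. s i (pr (c r))))
              (lincomb E (\<lambda>i. f i r) (\<lambda>i. nabla X (s i) (pr (c r))))"
    using assms(1) unfolding has_cov_deriv_def X_def by blast
  obtain t g where t: "\<And>i. smooth_section E (t i)" and g: "\<And>i. g i differentiable at r"
    and \<zeta>: "\<forall>\<^sub>F r in nhds r. \<zeta> r = lincomb E (\<lambda>i. g i r) (\<lambda>i. t i (pr (c r)))"
    and \<theta>: "\<theta> = vadd E (lincomb E (\<lambda>i. vector_derivative (g i) (at r)) (\<lambda>i. t i (pr (c r))))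
              (lincomb E (\<lambda>i. g i r) (\<lambda>i. nabla X (t i) (pr (c r))))"
    using assms(2) unfolding has_cov_deriv_def X_def by blast
  have fib: "s i x \<in> fibre E x" "t i x \<in> fibre E x"
      "nabla X (s i) x \<in> fibre E x" "nabla X (t i) x \<in> fibre E x" for i x
    using s t nabla_section [OF smooth_fun_const] unfolding X_def smooth_section_def by blast+
  let ?f' = "\<lambda>i. vector_derivative (f i) (at r)" and ?g' = "\<lambda>i. vector_derivative (g i) (at r)"
  let ?h = "\<lambda>i j r. h (s i (pr (c r))) (t j (pr (c r)))"
  let ?h' = "\<lambda>i j. h (nabla X (s i) (pr (c r))) (t j (pr (c r))) +
      h (s i (pr (c r))) (nabla X (t j) (pr (c r)))"
  have f': "(f i has_vector_derivative ?f' i) (at r)" and g': "(g i has_vector_derivative ?g' i) (at r)" for i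
    using f g by (simp_all add: vector_derivative_works [symmetric])
  have h': "(?h i j has_vector_derivative ?h' i j) (at r)" for i j
    using h_sections_along_curve [OF s t assms(3)] by (simp add: X_def)
  let ?G = "\<lambda>r. \<Sum>i\<in>UNIV. \<Sum>j\<in>UNIV. f i r * cnj (g j r) * ?h i j r"
  have G: "(?G has_vector_derivative (\<Sum>i\<in>UNIV. \<Sum>j\<in>UNIV.
      f i r * cnj (g j r) * ?h' i j + (f i r * cnj (?g' j) + ?f' i * cnj (g j r)) * ?h i j r)) (at r)"
    by (intro has_vector_derivative_sum has_vector_derivative_mult f' h' has_vector_derivative_cnj g')
  have "(\<Sum>i\<in>UNIV. \<Sum>j\<in>UNIV.
      f i r * cnj (g j r) * ?h' i j + (f i r * cnj (?g' j) + ?f' i * cnj (g j r)) * ?h i j r) =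
      h \<eta> (\<zeta> r) + h (\<xi> r) \<theta>"
    unfolding eventually_nhds_x_imp_x [OF \<xi>] eventually_nhds_x_imp_x [OF \<zeta>] \<eta> \<theta>
    by (simp add: fib h_add [of _ "pr (c r)"] h_add_right [of _ "pr (c r)"] h_lincomb [of _ "pr (c r)"]
        sum.distrib algebra_simps)
  moreover have "\<forall>\<^sub>F r in nhds r. ?G r = h (\<xi> r) (\<zeta> r)"
    using \<xi> \<zeta>
  proof eventually_elim
    case (elim r)
    then show ?case using fib by (simp add: h_lincomb [of _ "pr (c r)"])
  qed
  ultimately show ?thesis
    using G has_vector_derivative_transform_within_open unfolding eventually_nhds
    by (smt (verit, ccfv_threshold))
qed

lemma parallel_h_constant:
  assumes "parallel_along E nabla c \<xi>" "parallel_along E nabla c \<zeta>"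
    and "\<And>r. c differentiable (at r)"
  shows "h (\<xi> r) (\<zeta> r) = h (\<xi> 0) (\<zeta> 0)"
proof -
  have "((\<lambda>r. h (\<xi> r) (\<zeta> r)) has_vector_derivative 0) (at r)" for r
  proof -
    have fib: "\<xi> r \<in> fibre E (pr (c r))" "\<zeta> r \<in> fibre E (pr (c r))"
      and cov: "has_cov_deriv E nabla c \<xi> r (vscale E 0 (\<xi> r))" "has_cov_deriv E nabla c \<zeta> r (vscale E 0 (\<zeta> r))"
      using assms(1,2) by (auto simp: parallel_along_def)
    have "h (vscale E 0 (\<xi> r)) (\<zeta> r) + h (\<xi> r) (vscale E 0 (\<zeta> r)) = 0"
      using fib by (simp add: h_scale [of _ "pr (c r)"] h_scale_right [of _ "pr (c r)"])
    then show ?thesis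
      using h_cov_deriv [OF cov assms(3)] by simp
  qed
  then obtain k where "\<And>r. h (\<xi> r) (\<zeta> r) = k"
    using has_vector_derivative_zero_constant [of UNIV "\<lambda>r. h (\<xi> r) (\<zeta> r)"] by auto
  then show ?thesis by simp
qed

text \<open>
  The parallel frame is orthonormal at \<open>0\<close>, hence also at \<open>2\<pi>\<close>. Its value at \<open>2\<pi>\<close> is the value
  at \<open>0\<close> multiplied by \<open>D\<close>, so the columns of \<open>D\<close> are orthonormal.
\<close>
lemma monodromy_unitary:
  assumes "monodromy E nabla c v D" "orthonormal_basis E h (pr (c 0)) v"
    and "\<And>r. c differentiable (at r)"
  shows "conj_transpose D ** D = mat 1"
proof -
  obtain \<xi> where \<xi>: "\<And>j. parallel_along E nabla c (\<xi> j)" "\<And>j. \<xi> j 0 = v j"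
      "\<And>j t. \<xi> j (t + 2 * pi) = lincomb E (\<lambda>i. D $ i $ j) (\<lambda>i. \<xi> i t)"
    using assms(1) unfolding monodromy_def by blast
  have v: "\<And>i. v i \<in> fibre E (pr (c 0))" "\<And>i j. h (v i) (v j) = (if i = j then 1 else 0)"
    using assms(2) by (auto simp: orthonormal_basis_def)
  have "(\<Sum>k\<in>UNIV. cnj (D $ k $ i) * D $ k $ j) = (if i = j then 1 else 0)" for i j
  proof -
    have "(if j = i then 1 else 0) = h (\<xi> j (0 + 2 * pi)) (\<xi> i (0 + 2 * pi))"
      using parallel_h_constant [OF \<xi>(1,1) assms(3)] by (simp add: \<xi>(2) v)
    also have "\<dots> = (\<Sum>k\<in>UNIV. \<Sum>l\<in>UNIV. D $ k $ j * cnj (D $ l $ i) * (if k = l then 1 else 0))"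
      unfolding \<xi>(3) using v by (simp add: \<xi>(2) h_lincomb [of _ "pr (c 0)"])
    also have "\<dots> = (\<Sum>k\<in>UNIV. cnj (D $ k $ i) * D $ k $ j)"
      by (simp add: sum_2 mult.commute)
    finally show ?thesis by (simp add: eq_commute)
  qed
  then show ?thesis
    by (simp add: vec_eq_iff matrix_matrix_mult_def conj_transpose_def transpose_def mat_def)
qed

end

section \<open>Unitary matrices of size two\<close>

text \<open>
  The parametrisation of \<open>U(2)\<close> by a phase \<open>c\<close> and a unit quaternion \<open>(a, b)\<close>: the phase multiplies
  the matrix of \<open>SU(2)\<close> with first column \<open>(a, b)\<close>.
\<close>
definition U2_mat :: "complex \<Rightarrow> complex \<Rightarrow> complex \<Rightarrow> complex ^ 2 ^ 2" where
  "U2_mat c a b = vector [vector [c * a, - (c * cnj b)], vector [c * b, c * cnj a]]"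

lemma U2_mat_nth [simp]:
  "U2_mat c a b $ 1 $ 1 = c * a" "U2_mat c a b $ 1 $ 2 = - (c * cnj b)"
  "U2_mat c a b $ 2 $ 1 = c * b" "U2_mat c a b $ 2 $ 2 = c * cnj a"
  by (simp_all add: U2_mat_def)

lemma mat2_eq_iff:
  "A = B \<longleftrightarrow> A $ 1 $ 1 = B $ 1 $ 1 \<and> A $ 1 $ 2 = B $ 1 $ 2 \<and> A $ 2 $ 1 = B $ 2 $ 1 \<and> A $ 2 $ 2 = B $ 2 $ 2"
  for A B :: "'a ^ 2 ^ 2"
  by (auto simp: vec_eq_iff forall_2)

lemma mat2_mult_nth: "(A ** B) $ i $ j = A $ i $ 1 * B $ 1 $ j + A $ i $ 2 * B $ 2 $ j"
  for A B :: "complex ^ 2 ^ 2"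
  by (simp add: matrix_matrix_mult_def sum_2)

lemma mat_1_nth: "(mat 1 :: complex ^ 2 ^ 2) $ i $ j = (if i = j then 1 else 0)"
  by (simp add: mat_def)

lemma conj_transpose_nth [simp]: "conj_transpose A $ i $ j = cnj (A $ j $ i)"
  by (simp add: conj_transpose_def transpose_def)

lemma conj_transpose_conj_transpose [simp]: "conj_transpose (conj_transpose A) = A"
  by (simp add: mat2_eq_iff)

lemma U2_mat_mult:
  "U2_mat c a b ** U2_mat c' a' b' = U2_mat (c * c') (a * a' - cnj b * b') (b * a' + cnj a * b')"
  by (simp add: mat2_eq_iff mat2_mult_nth algebra_simps)

lemma conj_transpose_U2_mat: "conj_transpose (U2_mat c a b) = U2_mat (cnj c) (cnj a) (- b)"
  by (simp add: mat2_eq_iff)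

lemma U2_mat_one: "U2_mat 1 1 0 = mat 1"
  by (simp add: mat2_eq_iff mat_1_nth)

text \<open>
  Conjugates of the diagonal torus of \<open>SU(2)\<close>. The off-diagonal entries have modulus
  \<open>2 \<bar>a\<bar> \<bar>b\<bar> \<bar>Im z\<bar>\<close>, so a matrix with \<open>a \<noteq> 0\<close> and \<open>b \<noteq> 0\<close> moves the torus off the diagonal.
  The phase \<open>c\<close> cancels.
\<close>
lemma U2_mat_conj_torus:
  assumes "cmod c = 1"
  shows "U2_mat c a b ** U2_mat 1 z 0 ** conj_transpose (U2_mat c a b) =
    U2_mat 1 (z * (cmod a)\<^sup>2 + cnj z * (cmod b)\<^sup>2) (b * cnj a * (z - cnj z))"
proof -
  have "c * cnj c = 1"
    using assms by (simp add: complex_norm_square [symmetric])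
  then show ?thesis
    unfolding conj_transpose_U2_mat U2_mat_mult complex_norm_square
    by (simp add: algebra_simps)
qed

lemma cmod_eq_1_iff: "cmod z = 1 \<longleftrightarrow> z * cnj z = 1"
  unfolding complex_norm_square [symmetric] of_real_eq_1_iff power2_eq_1_iff
  using norm_ge_zero [of z] by linarith

lemma quaternion_norm_mult:
  "(cmod (a * a' - cnj b * b'))\<^sup>2 + (cmod (b * a' + cnj a * b'))\<^sup>2 =
   ((cmod a)\<^sup>2 + (cmod b)\<^sup>2) * ((cmod a')\<^sup>2 + (cmod b')\<^sup>2)"
  unfolding cmod_power2 by (simp add: power2_eq_square algebra_simps)

lemma conj_torus_norm:
  assumes "cmod z = 1" "(cmod a)\<^sup>2 + (cmod b)\<^sup>2 = 1"
  shows "(cmod (z * (cmod a)\<^sup>2 + cnj z * (cmod b)\<^sup>2))\<^sup>2 + (cmod (b * cnj a * (z - cnj z)))\<^sup>2 = 1"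
proof -
  \<comment> \<open>The two entries belong to the product of the quaternions \<open>(a z, b z)\<close> and \<open>(cnj a, - b)\<close>.\<close>
  have "z * (cmod a)\<^sup>2 + cnj z * (cmod b)\<^sup>2 = (a * z) * cnj a - cnj (b * z) * (- b)"
    "b * cnj a * (z - cnj z) = (b * z) * cnj a + cnj (a * z) * (- b)"
    unfolding complex_norm_square by (simp_all add: algebra_simps)
  then show ?thesis
    using assms by (simp only: quaternion_norm_mult) (simp add: norm_mult)
qed

lemma unit_sum_squares:
  assumes "(cmod a)\<^sup>2 + (cmod b)\<^sup>2 = 1"
  shows "a * cnj a + b * cnj b = 1"
  using assms by (metis complex_norm_square of_real_add of_real_1)

lemma carrier_U2_iff: "A \<in> carrier U2 \<longleftrightarrow> conj_transpose A ** A = mat 1"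
  using matrix_left_right_inverse [of A "conj_transpose A"] by (auto simp: U2_def)

lemma U2_mat_in_U2:
  assumes "cmod c = 1" "(cmod a)\<^sup>2 + (cmod b)\<^sup>2 = 1"
  shows "U2_mat c a b \<in> carrier U2"
proof -
  have "c * cnj c = 1" "a * cnj a + b * cnj b = 1"
    using assms unit_sum_squares by (simp_all add: complex_norm_square [symmetric])
  then show ?thesis
    unfolding carrier_U2_iff conj_transpose_U2_mat U2_mat_mult U2_mat_one [symmetric]
    by (simp add: algebra_simps)
qed

text \<open>
  A unitary matrix of determinant \<open>d\<close> satisfies \<open>A = d (adj A)\<^sup>*\<close>, which expresses the second
  column by the first one; dividing by a square root of \<open>d\<close> leaves an element of \<open>SU(2)\<close>.
\<close>
lemma U2_eq_U2_mat:
  assumes "A \<in> carrier U2"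
  obtains c a b where "cmod c = 1" "(cmod a)\<^sup>2 + (cmod b)\<^sup>2 = 1" "A = U2_mat c a b"
proof -
  let ?p = "A $ 1 $ 1" and ?q = "A $ 1 $ 2" and ?r = "A $ 2 $ 1" and ?s = "A $ 2 $ 2"
  have "conj_transpose A ** A = mat 1"
    using assms by (simp add: carrier_U2_iff)
  then have cols: "cnj ?p * ?p + cnj ?r * ?r = 1" "cnj ?p * ?q + cnj ?r * ?s = 0"
      "cnj ?q * ?q + cnj ?s * ?s = 1"
    by (simp_all add: mat2_eq_iff mat2_mult_nth mat_1_nth)
  define d where "d = ?p * ?s - ?q * ?r"
  have s: "?s = d * cnj ?p" and q: "?q = - (d * cnj ?r)"
    using cols unfolding d_def by algebra+
  \<comment> \<open>Both columns are unit vectors, and the second one is \<open>\<bar>d\<bar>\<close> times as long as the first.\<close>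
  have "d * cnj d * (cnj ?p * ?p + cnj ?r * ?r) = cnj ?q * ?q + cnj ?s * ?s"
    by (simp add: q s algebra_simps)
  then have "cmod d = 1"
    unfolding cmod_eq_1_iff using cols by simp
  define c where "c = csqrt d"
  have c: "c * c = d"
    using power2_csqrt [of d] by (simp add: c_def power2_eq_square)
  have nc: "cmod c = 1"
    using \<open>cmod d = 1\<close> by (simp add: c_def)
  then have cc: "c * cnj c = 1" by (simp add: complex_norm_square [symmetric])
  show thesis
  proof
    show "cmod c = 1" by fact
    have "(complex_of_real ((cmod (cnj c * ?p))\<^sup>2 + (cmod (cnj c * ?r))\<^sup>2)) = 1"
      using cols(1) nc by (simp add: norm_mult complex_norm_square mult.commute del: of_real_power)
    then show "(cmod (cnj c * ?p))\<^sup>2 + (cmod (cnj c * ?r))\<^sup>2 = 1"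
      using of_real_eq_1_iff by blast
    show "A = U2_mat c (cnj c * ?p) (cnj c * ?r)"
      using cc c s q by (simp add: mat2_eq_iff flip: mult.assoc)
  qed
qed

lemma closed_carrier_U2: "closed (carrier U2)"
proof -
  have "continuous_on UNIV (\<lambda>A. (conj_transpose A ** A) $ i $ j)" for i j
    unfolding mat2_mult_nth conj_transpose_nth by (intro continuous_intros)
  then have "closed (\<Inter>i j. {A. (conj_transpose A ** A) $ i $ j = mat 1 $ i $ j})"
    by (intro closed_INT ballI closed_Collect_eq continuous_on_const)
  moreover have "carrier U2 = (\<Inter>i j. {A. (conj_transpose A ** A) $ i $ j = mat 1 $ i $ j})"
    by (auto simp: carrier_U2_iff vec_eq_iff)
  ultimately show ?thesis by simp
qed

lemma continuous_on_U2_mat [continuous_intros]: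
  assumes "continuous_on S c" "continuous_on S a" "continuous_on S b"
  shows "continuous_on S (\<lambda>x. U2_mat (c x) (a x) (b x))"
proof -
  have "\<forall>i j. continuous_on S (\<lambda>x. U2_mat (c x) (a x) (b x) $ i $ j)"
    unfolding forall_2 U2_mat_nth by (intro conjI continuous_intros assms)
  then have "continuous_on S (\<lambda>x. \<chi> i j. U2_mat (c x) (a x) (b x) $ i $ j)"
    by (intro continuous_on_vec_lambda) auto
  then show ?thesis by simp
qed

section \<open>Closed subgroups of the unitary group\<close>

lemma group_U2: "group U2"
proof (rule groupI)
  fix A B assume *: "A \<in> carrier U2" "B \<in> carrier U2"
  have "conj_transpose (A ** B) = conj_transpose B ** conj_transpose A"
    by (simp add: mat2_eq_iff mat2_mult_nth mult.commute)
  then have "conj_transpose (A ** B) ** (A ** B) = conj_transpose B ** (conj_transpose A ** A) ** B"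
    by (simp add: matrix_mul_assoc)
  then show "A \<otimes>\<^bsub>U2\<^esub> B \<in> carrier U2"
    using * by (simp add: carrier_U2_iff) (simp add: U2_def carrier_U2_iff)
next
  show "\<one>\<^bsub>U2\<^esub> \<in> carrier U2"
    using U2_mat_in_U2 [of 1 1 0] by (simp add: U2_mat_one U2_def)
next
  fix A assume "A \<in> carrier U2"
  then show "\<exists>B\<in>carrier U2. B \<otimes>\<^bsub>U2\<^esub> A = \<one>\<^bsub>U2\<^esub>"
    by (intro bexI [of _ "conj_transpose A"]) (auto simp: U2_def)
qed (auto simp: U2_def matrix_mul_assoc)

lemma inv_U2:
  assumes "A \<in> carrier U2"
  shows "inv\<^bsub>U2\<^esub> A = conj_transpose A"
proof -
  interpret group U2 by (rule group_U2)
  show ?thesis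
    using assms by (intro inv_equality) (auto simp: U2_def)
qed

locale closed_unitary_group =
  fixes H :: "(complex ^ 2 ^ 2) set"
  assumes subset: "H \<subseteq> carrier U2"
    and closed: "closed H"
    and one: "mat 1 \<in> H"
    and mult: "A \<in> H \<Longrightarrow> B \<in> H \<Longrightarrow> A ** B \<in> H"
    and conj_transpose: "A \<in> H \<Longrightarrow> conj_transpose A \<in> H"

lemma closure_closed_unitary_group:
  assumes "subgroup G U2"
  shows "closed_unitary_group (closure G)"
proof
  \<comment> \<open>A continuous binary operation that preserves \<open>G\<close> preserves its closure.\<close>
  have closed_op: "mat_op x y \<in> closure G"
    if "x \<in> closure G" "y \<in> closure G" "continuous_on UNIV (\<lambda>(x, y). mat_op x y)"
      "\<And>x y. x \<in> G \<Longrightarrow> y \<in> G \<Longrightarrow> mat_op x y \<in> G" for mat_op x y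
  proof -
    have "(\<lambda>(x, y). mat_op x y) ` closure (G \<times> G) \<subseteq> closure G"
      using that closure_subset
      by (intro image_closure_subset) (auto intro: continuous_on_subset)
    then show ?thesis using that(1,2) by (auto simp: closure_Times)
  qed
  show "mat 1 \<in> closure G"
    using subgroup.one_closed [OF assms] closure_subset by (auto simp: U2_def)
  show "A ** B \<in> closure G" if "A \<in> closure G" "B \<in> closure G" for A B
  proof (rule closed_op [OF that])
    have "continuous_on UNIV (\<lambda>(A :: complex ^ 2 ^ 2, B :: complex ^ 2 ^ 2). (\<chi> i j. (A ** B) $ i $ j) :: complex ^ 2 ^ 2)"
      unfolding mat2_mult_nth case_prod_unfold
      by (intro continuous_on_vec_lambda continuous_intros)
    then show "continuous_on UNIV (\<lambda>(A :: complex ^ 2 ^ 2, B :: complex ^ 2 ^ 2). A ** B)" by simp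
    show "A ** B \<in> G" if "A \<in> G" "B \<in> G" for A B
      using subgroup.m_closed [OF assms that] by (simp add: U2_def)
  qed
  show "conj_transpose A \<in> closure G" if "A \<in> closure G" for A
  proof (rule closed_op [where mat_op = "\<lambda>A B. conj_transpose A", OF that that])
    have "continuous_on UNIV (\<lambda>(A :: complex ^ 2 ^ 2, B :: complex ^ 2 ^ 2). (\<chi> i j. conj_transpose A $ i $ j) :: complex ^ 2 ^ 2)"
      unfolding conj_transpose_nth case_prod_unfold
      by (intro continuous_on_vec_lambda continuous_intros)
    moreover have "(\<chi> i j. conj_transpose A $ i $ j) = conj_transpose A" for A
      by (simp add: vec_eq_iff)
    ultimately show "continuous_on UNIV (\<lambda>(A :: complex ^ 2 ^ 2, B :: complex ^ 2 ^ 2). conj_transpose A)"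
      by (simp only:)
    show "conj_transpose A \<in> G" if "A \<in> G" for A
      using subgroup.m_inv_closed [OF assms that] that subgroup.subset [OF assms] inv_U2 by fastforce
  qed
  show "closure G \<subseteq> carrier U2"
    using subgroup.subset [OF assms] closed_carrier_U2 by (rule closure_minimal)
qed simp

text \<open>
  Kronecker's theorem: the fractional parts of the multiples of an irrational number are dense in the
  unit interval, so their images are dense in the loop \<open>f\<close>.
\<close>
lemma irrational_multiples_fill_loop:
  fixes f :: "real \<Rightarrow> 'a::topological_space"
  assumes "\<theta> \<notin> \<rat>" "closed H" "continuous_on UNIV f"
    and periodic: "\<And>x k. f (x + of_int k) = f x"
    and H: "\<And>n. f (real n * \<theta>) \<in> H"
  shows "f t \<in> H"
proof -
  have frac: "f (frac x) = f x" for x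
    using periodic [of "frac x" "\<lfloor>x\<rfloor>"] by (simp add: frac_def)
  have "f ` closure (range (\<lambda>n. frac (real n * \<theta>))) \<subseteq> H"
    using assms frac by (intro image_closure_subset) (auto intro: continuous_on_subset)
  then have "f (frac t) \<in> H"
    using Kronecker_approx_1 [OF assms(1)] frac_lt_1 [of t] by (auto intro: less_imp_le)
  then show ?thesis by (simp add: frac)
qed

lemma cis_Arg_unit: "cmod z = 1 \<Longrightarrow> cis (Arg z) = z"
  using cis_Arg [of z] by (cases "z = 0") (auto simp: sgn_eq)

lemma unit_multiple:
  assumes "cmod w = cmod z"
  obtains u where "cmod u = 1" "w = u * z"
proof (cases "z = 0")
  case True
  then show thesis using that [of 1] assms by simp
next
  case False
  then show thesis using that [of "w / z"] assms by (simp add: norm_divide)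
qed

context closed_unitary_group
begin

lemma power_loop:
  fixes f :: "real \<Rightarrow> complex ^ 2 ^ 2"
  assumes hom: "\<And>x y. f (x + y) = f x ** f y" and f0: "f 0 = mat 1" and "f x \<in> H"
  shows "f (real n * x) \<in> H"
proof (induction n)
  case (Suc n)
  have "f (real (Suc n) * x) = f x ** f (real n * x)"
    by (simp add: hom [symmetric] algebra_simps)
  then show ?case using Suc assms mult by simp
qed (simp add: f0 one)

lemma one_parameter_loop_in:
  fixes f :: "real \<Rightarrow> complex ^ 2 ^ 2"
  assumes "\<theta> \<notin> \<rat>" and "continuous_on UNIV f" and "\<And>x y. f (x + y) = f x ** f y"
    and "\<And>k. f (of_int k) = mat 1" and "f \<theta> \<in> H"
  shows "f t \<in> H"
proof (rule irrational_multiples_fill_loop [OF assms(1) closed assms(2)])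
  show "f (x + of_int k) = f x" for x k
    by (simp add: assms)
  show "f (real n * \<theta>) \<in> H" for n
    using assms(4) [of 0] by (intro power_loop [OF assms(3) _ assms(5)]) simp
qed

text \<open>
  The argument \<open>\<psi>\<pi>/2\<close> is the fraction \<open>\<psi>/4\<close> of a full turn, and this fraction is irrational.
\<close>
lemma torus_from_irrational:
  assumes "\<psi> \<notin> \<rat>" "U2_mat 1 (cis (- (\<psi> * pi / 2))) 0 \<in> H" "cmod z = 1"
  shows "U2_mat 1 z 0 \<in> H"
proof -
  define f where "f x = U2_mat 1 (cis (- (2 * pi * x))) 0" for x
  have "\<psi> / 4 \<notin> \<rat>"
  proof
    assume "\<psi> / 4 \<in> \<rat>"
    then have "4 * (\<psi> / 4) \<in> \<rat>" by (intro Rats_mult) auto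
    then show False using assms(1) by simp
  qed
  then have "f t \<in> H" for t
  proof (rule one_parameter_loop_in)
    show "continuous_on UNIV f"
      unfolding f_def by (intro continuous_intros)
    show "f (x + y) = f x ** f y" for x y
      by (simp add: f_def U2_mat_mult cis_mult algebra_simps)
    show "f (of_int k) = mat 1" for k
      by (simp add: f_def U2_mat_one cis_cnj [symmetric] cis_multiple_2pi)
    show "f (\<psi> / 4) \<in> H"
      using assms(2) by (simp add: f_def algebra_simps)
  qed
  from this [of "- Arg z / (2 * pi)"] show ?thesis
    using cis_Arg_unit [OF assms(3)] by (simp add: f_def)
qed

lemma scalars_from_irrational:
  assumes "\<gamma> \<notin> \<rat>" "U2_mat (cis (\<gamma> * pi)) 1 0 \<in> H" "cmod z = 1"
  shows "U2_mat z 1 0 \<in> H"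
proof -
  define f where "f x = U2_mat (cis (2 * pi * x)) 1 0" for x
  have "\<gamma> / 2 \<notin> \<rat>"
  proof
    assume "\<gamma> / 2 \<in> \<rat>"
    then have "2 * (\<gamma> / 2) \<in> \<rat>" by (intro Rats_mult) auto
    then show False using assms(1) by simp
  qed
  then have "f t \<in> H" for t
  proof (rule one_parameter_loop_in)
    show "continuous_on UNIV f"
      unfolding f_def by (intro continuous_intros)
    show "f (x + y) = f x ** f y" for x y
      by (simp add: f_def U2_mat_mult cis_mult algebra_simps)
    show "f (of_int k) = mat 1" for k
      by (simp add: f_def U2_mat_one cis_multiple_2pi)
    show "f (\<gamma> / 2) \<in> H"
      using assms(2) by (simp add: f_def algebra_simps)
  qed
  from this [of "Arg z / (2 * pi)"] show ?thesis
    using cis_Arg_unit [OF assms(3)] by (simp add: f_def)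
qed

end

section \<open>Closed subgroups that contain the diagonal torus\<close>

locale closed_unitary_group_with_torus = closed_unitary_group +
  assumes torus: "cmod z = 1 \<Longrightarrow> U2_mat 1 z 0 \<in> H"
begin

text \<open>
  Multiplying by torus elements \<open>diag(z, cnj z)\<close> on the left and \<open>diag(w, cnj w)\<close> on the right
  changes \<open>(a, b)\<close> to \<open>(z w a, (cnj z) w b)\<close>, and the pair \<open>(z w, (cnj z) w)\<close> takes all values
  with both components of modulus \<open>1\<close>. Hence, for a fixed phase, membership in \<open>H\<close> depends only on \<open>\<bar>a\<bar>\<close> and \<open>\<bar>b\<bar>\<close>.
\<close>
lemma same_moduli:
  assumes "U2_mat c a b \<in> H" "cmod a' = cmod a" "cmod b' = cmod b"
  shows "U2_mat c a' b' \<in> H"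
proof -
  obtain p where p: "cmod p = 1" "a' = p * a" using unit_multiple assms by blast
  obtain q where q: "cmod q = 1" "b' = q * b" using unit_multiple assms by blast
  \<comment> \<open>The equations \<open>z w = p\<close> and \<open>(cnj z) w = q\<close> force \<open>w\<^sup>2 = p q\<close> and \<open>z = p (cnj w)\<close>.\<close>
  define w where "w = csqrt (p * q)"
  have w2: "w * w = p * q"
    using power2_csqrt [of "p * q"] by (simp add: w_def power2_eq_square)
  have "cmod w * cmod w = 1"
    using w2 p q by (metis norm_mult mult_1)
  then have "cmod w = 1"
    by (metis norm_ge_zero power2_eq_1_iff power2_eq_square neg_0_le_iff_le not_one_le_zero)
  then have w: "w * cnj w = 1" and pp: "p * cnj p = 1"
    using p by (simp_all add: complex_norm_square [symmetric])
  have "U2_mat 1 (p * cnj w) 0 ** U2_mat c a b ** U2_mat 1 w 0 \<in> H"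
    using assms \<open>cmod w = 1\<close> p by (intro mult torus) (simp_all add: norm_mult)
  moreover have "p * cnj w * a * w = a'"
    using w p by (simp add: mult.commute mult.left_commute)
  moreover have "cnj (p * cnj w) * b * w = b'"
  proof -
    have "cnj (p * cnj w) * b * w = cnj p * b * (w * w)" by (simp add: mult_ac)
    also have "\<dots> = (p * cnj p) * (q * b)" by (simp add: w2 mult_ac)
    finally show ?thesis using pp q by simp
  qed
  ultimately show ?thesis by (simp add: U2_mat_mult)
qed

text \<open>
  Conjugating \<open>diag(z, cnj z)\<close> by an element of \<open>H\<close> gives an off-diagonal entry of modulus
  \<open>2 \<bar>a\<bar> \<bar>b\<bar> \<bar>Im z\<bar>\<close>, which runs through \<open>[0, 2 \<bar>a\<bar> \<bar>b\<bar>]\<close> as \<open>z\<close> runs through the unit circle. So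
  every rotation whose sine lies in this interval has the moduli of an element of \<open>H\<close>.
\<close>
lemma small_rotation:
  fixes t :: real
  assumes "U2_mat c a b \<in> H" "cmod c = 1" "(cmod a)\<^sup>2 + (cmod b)\<^sup>2 = 1"
    and "0 \<le> sin t" "sin t \<le> 2 * cmod a * cmod b"
  shows "U2_mat 1 (cos t) (sin t) \<in> H"
proof -
  define m where "m = 2 * cmod a * cmod b"
  have "0 \<le> m" by (simp add: m_def)
  \<comment> \<open>The imaginary part that \<open>z\<close> has to have. For \<open>m = 0\<close> also \<open>sin t = 0\<close>, and \<open>z = 1\<close> serves.\<close>
  define s where "s = (if m = 0 then 0 else sin t / m)"
  have s: "0 \<le> s" "s \<le> 1" "s * m = sin t"
    using assms(4,5) \<open>0 \<le> m\<close> by (auto simp: s_def m_def [symmetric] divide_simps)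
  define z where "z = cis (arcsin s)"
  define a' where "a' = z * (cmod a)\<^sup>2 + cnj z * (cmod b)\<^sup>2"
  define b' where "b' = b * cnj a * (z - cnj z)"
  have conj_in: "U2_mat 1 a' b' \<in> H"
    using U2_mat_conj_torus [OF assms(2), of a b z] assms(1)
    by (metis a'_def b'_def mult torus conj_transpose norm_cis z_def)
  have nb: "cmod b' = \<bar>sin t\<bar>"
  proof -
    have "z - cnj z = 2 * \<i> * s"
      using s by (simp add: z_def complex_eq_iff)
    then have "cmod b' = m * s"
      using s by (simp add: b'_def m_def norm_mult)
    then show ?thesis using s assms(4) by (simp add: mult.commute)
  qed
  have na: "cmod a' = \<bar>cos t\<bar>"
  proof -
    have "(cmod a')\<^sup>2 + (cmod b')\<^sup>2 = 1"
      unfolding a'_def b'_def using assms(3) by (intro conj_torus_norm) (simp_all add: z_def)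
    then have "(cmod a')\<^sup>2 = (cos t)\<^sup>2"
      using nb by (simp add: cos_squared_eq)
    then show ?thesis
      by (metis abs_norm_cancel power2_eq_iff abs_minus)
  qed
  show ?thesis
    by (rule same_moduli [OF conj_in]) (simp_all add: na nb)
qed

text \<open>
  A rotation by any angle is a power of a rotation by a small angle.
\<close>
lemma rotation:
  fixes t :: real
  assumes "U2_mat c a b \<in> H" "cmod c = 1" "(cmod a)\<^sup>2 + (cmod b)\<^sup>2 = 1"
    and "a \<noteq> 0" "b \<noteq> 0" "0 \<le> t"
  shows "U2_mat 1 (cos t) (sin t) \<in> H"
proof -
  \<comment> \<open>For \<open>0 \<le> x < \<delta>\<close> one has \<open>0 \<le> sin x \<le> x \<le> 2 \<bar>a\<bar> \<bar>b\<bar>\<close>; the bound \<open>1\<close> keeps \<open>x\<close> below \<open>\<pi>\<close>.\<close>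
  define \<delta> where "\<delta> = min 1 (2 * cmod a * cmod b)"
  have "0 < \<delta>" using assms by (simp add: \<delta>_def)
  obtain n where "t < real n * \<delta>"
    using reals_Archimedean3 [OF \<open>0 < \<delta>\<close>] by blast
  moreover from this assms(6) have "0 < n"
    by (cases n) auto
  ultimately have n: "t < real n * \<delta>" "0 < n" by auto
  define f where "f x = U2_mat 1 (complex_of_real (cos x)) (complex_of_real (sin x))" for x
  have tn: "0 \<le> t / n" "t / n < \<delta>"
    using n assms(6) by (simp_all add: divide_simps mult.commute)
  have "f (real n * (t / n)) \<in> H"
  proof (rule power_loop)
    show "f (x + y) = f x ** f y" for x y
      by (simp add: f_def U2_mat_mult cos_add sin_add algebra_simps)
    show "f 0 = mat 1" by (simp add: f_def U2_mat_one)
    have "0 \<le> sin (t / n)"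
      using tn pi_gt3 by (intro sin_ge_zero) (auto simp: \<delta>_def)
    moreover have "sin (t / n) \<le> 2 * cmod a * cmod b"
      using sin_x_le_x [OF tn(1)] tn(2) by (simp add: \<delta>_def)
    ultimately show "f (t / n) \<in> H"
      unfolding f_def using small_rotation assms by blast
  qed
  then show ?thesis using n by (simp add: f_def)
qed

text \<open>
  Every pair of moduli of a unit quaternion is \<open>(cos t, sin t)\<close> for some \<open>t \<ge> 0\<close>, so the rotations
  suffice by \<open>same_moduli\<close>.
\<close>
lemma special_unitary:
  assumes "U2_mat c a b \<in> H" "cmod c = 1" "(cmod a)\<^sup>2 + (cmod b)\<^sup>2 = 1"
    and "a \<noteq> 0" "b \<noteq> 0"
    and "(cmod a')\<^sup>2 + (cmod b')\<^sup>2 = 1"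
  shows "U2_mat 1 a' b' \<in> H"
proof -
  obtain t where t: "0 \<le> t" "cmod a' = cos t" "cmod b' = sin t"
    using sincos_total_pi_half [of "cmod a'" "cmod b'"] assms(6) by auto
  show ?thesis
    by (rule same_moduli [OF rotation [OF assms(1-5) t(1)]]) (simp_all flip: t(2,3))
qed

text \<open>
  Once \<open>SU(2)\<close> lies in \<open>H\<close>, the quaternion part of the given element can be divided out, leaving the
  scalar \<open>e\<^bsup>i\<gamma>\<pi>\<^esup>\<close>. Its powers are dense in the scalars of modulus \<open>1\<close>, and \<open>U(2)\<close> is the product of
  these scalars and \<open>SU(2)\<close>.
\<close>
lemma all_unitary:
  assumes "U2_mat (cis (\<gamma> * pi)) a b \<in> H" "(cmod a)\<^sup>2 + (cmod b)\<^sup>2 = 1"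
    and "a \<noteq> 0" "b \<noteq> 0" "\<gamma> \<notin> \<rat>"
  shows "H = carrier U2"
proof (rule equalityI [OF subset subsetI])
  fix A assume "A \<in> carrier U2"
  then obtain c a' b' where A: "cmod c = 1" "(cmod a')\<^sup>2 + (cmod b')\<^sup>2 = 1" "A = U2_mat c a' b'"
    by (rule U2_eq_U2_mat)
  have SU: "U2_mat 1 a' b' \<in> H" if "(cmod a')\<^sup>2 + (cmod b')\<^sup>2 = 1" for a' b'
    using special_unitary [OF assms(1) norm_cis assms(2-4) that] .
  have "U2_mat 1 (cnj a) (- b) \<in> H"
    using assms(2) by (intro SU) simp
  with assms(1) have "U2_mat (cis (\<gamma> * pi)) a b ** U2_mat 1 (cnj a) (- b) \<in> H"
    by (rule mult)
  moreover have "a * cnj a + b * cnj b = 1"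
    using assms(2) by (rule unit_sum_squares)
  ultimately have "U2_mat (cis (\<gamma> * pi)) 1 0 \<in> H"
    by (simp add: U2_mat_mult algebra_simps)
  then have "U2_mat c 1 0 \<in> H"
    using scalars_from_irrational assms(5) A(1) by blast
  then have "U2_mat c 1 0 ** U2_mat 1 a' b' \<in> H"
    using SU [OF A(2)] by (rule mult)
  then show "A \<in> H" by (simp add: A(3) U2_mat_mult)
qed

end

section \<open>Density\<close>

text \<open>
  The diagonal entries of \<open>U B(q\<pi>) U\<^sup>*\<close> have real part \<open>cos (q\<pi>/2)\<close> and the off-diagonal ones have
  modulus \<open>2 \<bar>\<alpha>\<bar> \<bar>\<beta>\<bar> \<bar>sin (q\<pi>/2)\<bar>\<close>. As \<open>q\<close> is not an integer, neither
  trigonometric factor vanishes, so this matrix does not normalise the diagonal torus.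
\<close>
lemma dense_of_generators:
  fixes \<alpha> \<beta> :: complex and \<psi> \<gamma> q :: real
  assumes G: "subgroup G U2"
    and "Bmat (\<psi> * pi) \<in> G"
    and "map_matrix (\<lambda>z. exp (\<i> * (\<gamma> * pi)) * z) (U ** Bmat (q * pi) ** conj_transpose U) \<in> G"
    and U: "U = vector [vector [\<alpha>, - cnj \<beta>], vector [\<beta>, cnj \<alpha>]]"
    and unit: "(cmod \<alpha>)\<^sup>2 + (cmod \<beta>)\<^sup>2 = 1"
    and "\<alpha> \<noteq> 0" "\<beta> \<noteq> 0" "q \<notin> \<int>" "\<psi> \<notin> \<rat>" "\<gamma> \<notin> \<rat>"
  shows "closure G = carrier U2"
proof -
  interpret closed_unitary_group "closure G"
    using G by (rule closure_closed_unitary_group)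
  have Bmat: "Bmat \<theta> = U2_mat 1 (cis (- (\<theta> / 2))) 0" for \<theta>
    by (simp add: Bmat_def U2_mat_def cis_conv_exp cis_cnj [symmetric])
      (simp add: cis_conv_exp exp_cnj)
  interpret closed_unitary_group_with_torus "closure G"
  proof
    show "U2_mat 1 z 0 \<in> closure G" if "cmod z = 1" for z
      using torus_from_irrational [OF \<open>\<psi> \<notin> \<rat>\<close> _ that] assms(2) closure_subset
      by (auto simp: Bmat)
  qed
  define z where "z = cis (- (q * pi / 2))"
  define a where "a = z * (cmod \<alpha>)\<^sup>2 + cnj z * (cmod \<beta>)\<^sup>2"
  define b where "b = \<beta> * cnj \<alpha> * (z - cnj z)"
  have "sin (q * pi) \<noteq> 0"
    using \<open>q \<notin> \<int>\<close> by (auto simp: sin_zero_iff_int2)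
  then have sc: "sin (q * pi / 2) \<noteq> 0" "cos (q * pi / 2) \<noteq> 0"
    using sin_double [of "q * pi / 2"] by auto
  have "U = U2_mat 1 \<alpha> \<beta>" by (simp add: U U2_mat_def)
  then have V: "U ** Bmat (q * pi) ** conj_transpose U = U2_mat 1 a b"
    by (simp add: Bmat U2_mat_conj_torus a_def b_def z_def)
  show "closure G = carrier U2"
  proof (rule all_unitary)
    have "map_matrix (\<lambda>z. exp (\<i> * (\<gamma> * pi)) * z) (U2_mat 1 a b) = U2_mat (cis (\<gamma> * pi)) a b"
      by (simp add: mat2_eq_iff cis_conv_exp)
    then show "U2_mat (cis (\<gamma> * pi)) a b \<in> closure G"
      using assms(3) closure_subset V by auto
    have "Re a = cos (q * pi / 2) * ((cmod \<alpha>)\<^sup>2 + (cmod \<beta>)\<^sup>2)"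
      by (simp add: a_def z_def algebra_simps flip: of_real_power)
    then show "a \<noteq> 0" using sc unit by auto
    have "Im (z - cnj z) \<noteq> 0" using sc by (simp add: z_def)
    then have "z - cnj z \<noteq> 0" by (metis zero_complex.sel(2))
    then show "b \<noteq> 0" using assms by (simp add: b_def)
    show "(cmod a)\<^sup>2 + (cmod b)\<^sup>2 = 1"
      unfolding a_def b_def using unit by (intro conj_torus_norm) (simp_all add: z_def)
  qed fact
qed

theorem theorem8p5:
  fixes E :: "'e vbundle"
    and h :: "'e \<Rightarrow> 'e \<Rightarrow> complex"
    and nabla :: "(torus \<Rightarrow> real \<times> real) \<Rightarrow> (torus \<Rightarrow> 'e) \<Rightarrow> torus \<Rightarrow> 'e"
    and v :: "2 \<Rightarrow> 'e"
    and B1 B2 U :: "complex ^ 2 ^ 2"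
    and \<alpha> \<beta> :: complex
    and \<phi> \<psi> \<gamma> q :: real
  assumes "h_connection E h nabla"
    and "orthonormal_basis E h (pr (0, 0)) v"
    and "B1 \<in> topological_holonomy_group E nabla v"
    and "B2 \<in> topological_holonomy_group E nabla v"
    and "B1 = Bmat (\<psi> * pi)"
    and "B2 = map_matrix (\<lambda>z. exp (\<i> * (\<gamma> * pi)) * z) (U ** Bmat (q * pi) ** conj_transpose U)"
    and "U = vector [vector [\<alpha>, - cnj \<beta>], vector [\<beta>, cnj \<alpha>]]"
    and "(cmod \<alpha>)\<^sup>2 + (cmod \<beta>)\<^sup>2 = 1"
    and "cos \<phi> = (cmod \<alpha>)\<^sup>2 - (cmod \<beta>)\<^sup>2"
    and "\<phi> \<in> {0<..pi / 2}"
    and "q \<in> \<rat>" and "q \<notin> \<int>"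
    and "\<psi> \<notin> \<rat>" and "\<gamma> \<notin> \<rat>"
  shows "closure (topological_holonomy_group E nabla v) = carrier U2"
proof -
  interpret h_connection E h nabla by fact
  let ?D = "{D. monodromy E nabla x_axis v D \<or> monodromy E nabla y_axis v D}"
  have "x_axis differentiable (at r)" for r
    unfolding x_axis_def [abs_def]
    by (rule differentiableI [OF has_derivative_Pair [OF has_derivative_ident has_derivative_const]])
  moreover have "y_axis differentiable (at r)" for r
    unfolding y_axis_def [abs_def]
    by (rule differentiableI [OF has_derivative_Pair [OF has_derivative_const has_derivative_ident]])
  moreover have "x_axis 0 = (0, 0)" "y_axis 0 = (0, 0)"
    by (simp_all add: x_axis_def y_axis_def)
  ultimately have "?D \<subseteq> carrier U2"
    using assms(2) monodromy_unitary by (auto simp: carrier_U2_iff)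
  then have "subgroup (topological_holonomy_group E nabla v) U2"
    unfolding topological_holonomy_group_def by (rule group.generate_is_subgroup [OF group_U2])
  \<comment> \<open>\<open>\<alpha> = 0\<close> would mean \<open>cos \<phi> = -1\<close>, and \<open>\<beta> = 0\<close> would mean \<open>cos \<phi> = 1\<close>.\<close>
  moreover have "\<alpha> \<noteq> 0" "\<beta> \<noteq> 0"
  proof -
    have "0 \<le> cos \<phi>"
      using assms(10) by (intro cos_ge_zero) auto
    then show "\<alpha> \<noteq> 0" using assms(8,9) by auto
    have "cos \<phi> < cos 0"
      using assms(10) pi_gt_zero by (intro cos_monotone_0_pi) auto
    then show "\<beta> \<noteq> 0" using assms(8,9) by auto
  qed
  ultimately show ?thesis
    using assms by (intro dense_of_generators [of _ \<psi> \<gamma> U q \<alpha> \<beta>]) auto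
qed

end
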